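(* Let $1<p\le\infty$. Then for each measurable function $\alpha:[0,1]\to[0,\infty)$ with $\alpha(t)>0$ for almost every $t\in[0,1]$, the mapping $R^{\alpha(\cdot)}$ is a bounded operator from $L_p[0,1]$ to $L_p[0,1]$. Moreover, there is a constant $c_p>0$, independent of $\alpha(\cdot)$, such that $$\|R^{\alpha(\cdot)}:L_p[0,1]\to L_p[0,1]\|\le c_p .$$
   Context: For a measurable function $\alpha:[0,1]\to[0,\infty)$ with $\alpha(t)>0$ for almost every $t$, the Riemann--Liouville operator of variable order is $$(R^{\alpha(\cdot)}f)(t):=\frac{1}{\Gamma(\alpha(t))}\int_0^t (t-s)^{\alpha(t)-1}f(s)\,ds,\qquad t\in[0,1],$$ for $f\in L_1[0,1]$ (the integral exists for almost every $t$). *)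

theory Defs
  imports "HOL-Analysis.Analysis" "HOL-Probability.Essential_Supremum"
begin

text \<open>
  Elements of \<open>L\<^sub>p\<close> are represented by functions, not by classes modulo almost
  everywhere equality; the compatibility of operators with this equality is part of
  \<open>bounded_Lp_operator\<close> below. Scalars are real, and the exponent may be \<open>\<infinity>\<close>.
\<close>

definition Lp_space :: "ennreal \<Rightarrow> 'a measure \<Rightarrow> ('a \<Rightarrow> real) set" where
  "Lp_space p M = {f \<in> borel_measurable M.
     if p = \<infinity> then esssup M (\<lambda>x. ereal \<bar>f x\<bar>) < \<infinity>
     else integrable M (\<lambda>x. \<bar>f x\<bar> powr enn2real p)}"

text \<open>The value of \<open>Lp_norm\<close> is meaningful only on \<open>Lp_space\<close>.\<close>

definition Lp_norm :: "ennreal \<Rightarrow> 'a measure \<Rightarrow> ('a \<Rightarrow> real) \<Rightarrow> real" where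
  "Lp_norm p M f =
     (if p = \<infinity> then real_of_ereal (esssup M (\<lambda>x. ereal \<bar>f x\<bar>))
      else (LINT x|M. \<bar>f x\<bar> powr enn2real p) powr (1 / enn2real p))"

definition bounded_Lp_operator ::
    "ennreal \<Rightarrow> 'a measure \<Rightarrow> (('a \<Rightarrow> real) \<Rightarrow> ('a \<Rightarrow> real)) \<Rightarrow> bool" where
  "bounded_Lp_operator p M T \<longleftrightarrow>
     (\<forall>f\<in>Lp_space p M. T f \<in> Lp_space p M) \<and>
     (\<forall>f\<in>Lp_space p M. \<forall>g\<in>Lp_space p M.
        (AE x in M. f x = g x) \<longrightarrow> (AE x in M. T f x = T g x)) \<and>
     (\<forall>f\<in>Lp_space p M. \<forall>g\<in>Lp_space p M.
        AE x in M. T (\<lambda>y. f y + g y) x = T f x + T g x) \<and>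
     (\<forall>f\<in>Lp_space p M. \<forall>a. AE x in M. T (\<lambda>y. a * f y) x = a * T f x) \<and>
     (\<exists>C. \<forall>f\<in>Lp_space p M. Lp_norm p M (T f) \<le> C * Lp_norm p M f)"

definition Lp_opnorm ::
    "ennreal \<Rightarrow> 'a measure \<Rightarrow> (('a \<Rightarrow> real) \<Rightarrow> ('a \<Rightarrow> real)) \<Rightarrow> ereal" where
  "Lp_opnorm p M T =
     (SUP f\<in>{f \<in> Lp_space p M. Lp_norm p M f \<le> 1}. ereal (Lp_norm p M (T f)))"

abbreviation unit_interval_measure :: "real measure" where
  "unit_interval_measure \<equiv> lebesgue_on {0..1}"

definition variable_order :: "(real \<Rightarrow> real) \<Rightarrow> bool" where
  "variable_order \<alpha> \<longleftrightarrow>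
     \<alpha> \<in> borel_measurable unit_interval_measure \<and>
     (\<forall>t\<in>{0..1}. 0 \<le> \<alpha> t) \<and>
     (AE t in unit_interval_measure. 0 < \<alpha> t)"

definition RL_integrand :: "(real \<Rightarrow> real) \<Rightarrow> (real \<Rightarrow> real) \<Rightarrow> real \<Rightarrow> real \<Rightarrow> real" where
  "RL_integrand \<alpha> f t s = (t - s) powr (\<alpha> t - 1) * f s"

text \<open>
  The Bochner integral is \<open>0\<close> where the integrand is not integrable, and \<open>1 / Gamma 0 = 0\<close>.
\<close>

definition RL_operator :: "(real \<Rightarrow> real) \<Rightarrow> (real \<Rightarrow> real) \<Rightarrow> real \<Rightarrow> real" where
  "RL_operator \<alpha> f t =
     1 / Gamma (\<alpha> t) * (LINT s:{0..t}|lebesgue. RL_integrand \<alpha> f t s)"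

end

theory Submission imports Defs begin

text \<open>
  The operator is dominated pointwise by a maximal function, with a constant that does
  not depend on the order. Write \<open>M f t\<close> for the supremum over \<open>k\<close> of the averages of
  \<open>\<bar>f\<bar>\<close> (up to a factor \<open>2\<close>) over the windows \<open>[t - 2 powr - k, t + 2 powr - k]\<close>.
  Fix \<open>t\<close> in the unit interval and \<open>a = \<alpha> t > 0\<close>. On the shell
  \<open>2 powr (- k - 1) < t - s \<le> 2 powr - k\<close> the kernel \<open>(t - s) powr (a - 1)\<close> is at most twice
  \<open>(2 powr - a) ^ k * 2 ^ k\<close>. Summing the geometric series over all shells bounds the
  integral by \<open>2 / (1 - 2 powr - a) * M f t\<close>. The series blows up like \<open>1 / a\<close> as
  \<open>a\<close> tends to \<open>0\<close>, but \<open>1 / Gamma a\<close> vanishes like \<open>a\<close>, so their product is bounded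
  uniformly in \<open>a > 0\<close> (\<open>RL_constant_bound\<close>). Hence
  \<open>\<bar>RL_operator \<alpha> f t\<bar> \<le> C * M f t\<close> with an absolute constant \<open>C\<close>
  (\<open>RL_operator_le_dyadic_maximal\<close>).

  For \<open>p = \<infinity>\<close> one has \<open>M f \<le> 2 * N\<close> whenever \<open>\<bar>f\<bar> \<le> N\<close> almost everywhere. For
  finite \<open>p > 1\<close> the maximal function satisfies the Hardy--Littlewood inequality: the Vitali
  covering lemma gives the weak type \<open>(1,1)\<close> estimate \<open>dyadic_maximal_weak_type\<close>, and
  integrating it over the levels, after truncating \<open>f\<close> at each level, gives
  \<open>dyadic_maximal_strong_type\<close>. The constants involve only \<open>p\<close>.

  Joint measurability of the kernel in \<open>(t, s)\<close> is needed for the measurability of the image.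
  It is available for Borel data, so \<open>f\<close> and \<open>\<alpha>\<close> are first replaced by Borel
  functions equal to them almost everywhere on the unit interval.
\<close>

section \<open>The dyadic maximal function\<close>

text \<open>
  The centred Hardy--Littlewood maximal function, restricted to the radii \<open>2 powr - k\<close>, which
  makes the supremum countable. The window has length \<open>2 * (1/2) ^ k\<close>, so the factor \<open>2 ^ k\<close>
  gives twice the average. The value lies in \<open>ennreal\<close>, so no integrability of \<open>f\<close> is
  required.
\<close>

definition dyadic_maximal :: "(real \<Rightarrow> real) \<Rightarrow> real \<Rightarrow> ennreal" where
  "dyadic_maximal f t =
     (SUP k. 2 ^ k * (\<integral>\<^sup>+ s\<in>{t - (1/2) ^ k..t + (1/2) ^ k}. ennreal \<bar>f s\<bar> \<partial>lborel))"

lemma dyadic_maximal_upper: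
  "2 ^ k * (\<integral>\<^sup>+ s\<in>{t - (1/2) ^ k..t + (1/2) ^ k}. ennreal \<bar>f s\<bar> \<partial>lborel) \<le> dyadic_maximal f t"
  unfolding dyadic_maximal_def by (rule SUP_upper) simp

lemma pow2_mult_pow_half_ennreal: "2 ^ k * ennreal ((1/2) ^ k) = 1"
proof -
  have "2 ^ k * ennreal ((1/2) ^ k) = ennreal (2 ^ k * (1/2) ^ k)"
    by (subst ennreal_mult) (auto simp flip: ennreal_power)
  also have "(2::real) ^ k * (1/2) ^ k = 1"
    by (simp flip: power_mult_distrib)
  finally show ?thesis by simp
qed

lemma borel_measurable_dyadic_maximal [measurable]:
  assumes [measurable]: "f \<in> borel_measurable borel"
  shows "dyadic_maximal f \<in> borel_measurable borel"
proof -
  have eq: "indicator {t - r..t + r} s = (if t - r \<le> s \<and> s \<le> t + r then 1 else (0::ennreal))"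
    for t r s :: real by (simp add: indicator_def)
  show ?thesis
    unfolding dyadic_maximal_def eq by measurable
qed

text \<open>
  Weak type \<open>(1,1)\<close>. Every point of the level set is the centre of a window on which the integral
  of \<open>\<bar>f\<bar>\<close> exceeds \<open>c\<close> times the radius. The Vitali lemma selects countably many disjoint
  windows whose fivefold dilations cover the level set; each dilation has length \<open>10\<close> times
  the radius.
\<close>

lemma dyadic_maximal_weak_type:
  assumes [measurable]: "f \<in> borel_measurable borel"
  shows "ennreal c * emeasure lborel {t. ennreal c < dyadic_maximal f t}
         \<le> 10 * (\<integral>\<^sup>+ s. ennreal \<bar>f s\<bar> \<partial>lborel)"
proof -
  define S where "S = {t. ennreal c < dyadic_maximal f t}"
  have [measurable]: "S \<in> sets borel" unfolding S_def by measurable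
  have "\<exists>k. ennreal c < 2 ^ k * (\<integral>\<^sup>+ s\<in>{t - (1/2) ^ k..t + (1/2) ^ k}. ennreal \<bar>f s\<bar> \<partial>lborel)"
    if "t \<in> S" for t
    using that unfolding S_def dyadic_maximal_def by (auto simp: less_SUP_iff)
  then obtain k where k: "\<And>t. t \<in> S \<Longrightarrow>
      ennreal c < 2 ^ k t * (\<integral>\<^sup>+ s\<in>{t - (1/2) ^ k t..t + (1/2) ^ k t}. ennreal \<bar>f s\<bar> \<partial>lborel)"
    by metis
  define r where "r t = (1/2::real) ^ k t" for t
  have r: "0 < r t \<and> r t \<le> 1" for t
    unfolding r_def by (simp add: power_le_one)
  have cover: "S \<subseteq> (\<Union>i\<in>S. cball i (r i))"
    using r by (auto intro!: bexI[of _ x for x] simp: less_imp_le)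
  obtain C where C: "countable C" "C \<subseteq> S"
      "pairwise (\<lambda>i j. disjnt (cball i (r i)) (cball j (r j))) C"
      "S \<subseteq> (\<Union>i\<in>C. cball i (5 * r i))"
    by (rule Vitali_covering_lemma_cballs[where S = S and K = S and a = "\<lambda>i. i" and r = r and B = 1,
          OF cover r])
  define N where "N = density lborel (\<lambda>s. ennreal \<bar>f s\<bar>)"
  have ball: "ennreal (c * (10 * r i)) \<le> 10 * emeasure N (cball i (r i))" if "i \<in> C" for i
  proof -
    have eN: "emeasure N (cball i (r i)) = (\<integral>\<^sup>+ s\<in>{i - r i..i + r i}. ennreal \<bar>f s\<bar> \<partial>lborel)"
      unfolding N_def by (subst emeasure_density) (auto simp: cball_eq_atLeastAtMost)
    have "ennreal (r i) * ennreal c \<le> ennreal (r i) * (2 ^ k i * emeasure N (cball i (r i)))"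
      using k[of i, folded r_def] that C(2) unfolding eN by (intro mult_left_mono) auto
    also have "\<dots> = (2 ^ k i * ennreal (r i)) * emeasure N (cball i (r i))"
      by (simp add: mult_ac)
    also have "2 ^ k i * ennreal (r i) = 1"
      unfolding r_def by (rule pow2_mult_pow_half_ennreal)
    finally have "10 * ennreal (r i * c) \<le> 10 * emeasure N (cball i (r i))"
      using r[of i] by (intro mult_left_mono) (auto simp: ennreal_mult')
    also have "10 * ennreal (r i * c) = ennreal (c * (10 * r i))"
      using ennreal_mult'[of 10 "r i * c"] by (simp add: mult_ac)
    finally show ?thesis .
  qed
  \<comment> \<open>Countable subadditivity over \<open>C\<close>, written as an exchange of integrals because \<open>C\<close> is
    not indexed by the natural numbers.\<close>
  have "emeasure lborel S \<le> (\<integral>\<^sup>+ t. (\<integral>\<^sup>+ i. indicator (cball i (5 * r i)) t \<partial>count_space C) \<partial>lborel)"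
  proof -
    have "indicator S t \<le> (\<integral>\<^sup>+ i. indicator (cball i (5 * r i)) t \<partial>count_space C)" for t
    proof (cases "t \<in> S")
      case True
      then obtain i where i: "i \<in> C" "t \<in> cball i (5 * r i)" using C(4) by blast
      have "(1::ennreal) = (\<integral>\<^sup>+ j. indicator {i} j \<partial>count_space C)"
        using i by (simp add: emeasure_count_space_finite one_ennreal_def[symmetric])
      also have "\<dots> \<le> (\<integral>\<^sup>+ i. indicator (cball i (5 * r i)) t \<partial>count_space C)"
        using i by (intro nn_integral_mono) (auto simp: indicator_def)
      finally show ?thesis using True by simp
    qed simp
    then have "(\<integral>\<^sup>+ t. indicator S t \<partial>lborel)
        \<le> (\<integral>\<^sup>+ t. (\<integral>\<^sup>+ i. indicator (cball i (5 * r i)) t \<partial>count_space C) \<partial>lborel)"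
      by (intro nn_integral_mono)
    then show ?thesis by simp
  qed
  also have "\<dots> = (\<integral>\<^sup>+ i. (\<integral>\<^sup>+ t. indicator (cball i (5 * r i)) t \<partial>lborel) \<partial>count_space C)"
    using C(1) by (intro nn_integral_count_space_nn_integral) (auto simp: cball_eq_atLeastAtMost)
  also have "\<dots> = (\<integral>\<^sup>+ i. ennreal (10 * r i) \<partial>count_space C)"
    using r by (intro nn_integral_cong) (auto simp: cball_eq_atLeastAtMost less_imp_le)
  finally have "ennreal c * emeasure lborel S
      \<le> ennreal c * (\<integral>\<^sup>+ i. ennreal (10 * r i) \<partial>count_space C)"
    by (intro mult_left_mono) auto
  also have "\<dots> = (\<integral>\<^sup>+ i. ennreal (c * (10 * r i)) \<partial>count_space C)"
    using r by (subst nn_integral_cmult[symmetric]) (auto simp: ennreal_mult'' less_imp_le)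
  also have "\<dots> \<le> (\<integral>\<^sup>+ i. 10 * emeasure N (cball i (r i)) \<partial>count_space C)"
    using ball by (intro nn_integral_mono) auto
  also have "\<dots> = 10 * (\<integral>\<^sup>+ i. emeasure N (cball i (r i)) \<partial>count_space C)"
    by (subst nn_integral_cmult) auto
  also have "(\<integral>\<^sup>+ i. emeasure N (cball i (r i)) \<partial>count_space C)
      = emeasure N (\<Union>i\<in>C. cball i (r i))"
    using C by (intro emeasure_UN_countable[symmetric])
      (auto simp: N_def disjoint_family_on_def pairwise_def disjnt_def)
  also have "\<dots> \<le> emeasure N (space N)"
    by (rule emeasure_space)
  also have "\<dots> = (\<integral>\<^sup>+ s. ennreal \<bar>f s\<bar> \<partial>lborel)"
    unfolding N_def by (subst emeasure_density) auto
  finally show ?thesis unfolding S_def by (simp add: mult_left_mono)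
qed

text \<open>
  The set where the maximal function is infinite lies in every level set, so the weak type
  estimate forces its measure to vanish.
\<close>

lemma dyadic_maximal_finite_AE:
  assumes [measurable]: "f \<in> borel_measurable borel"
    and fin: "(\<integral>\<^sup>+ s. ennreal \<bar>f s\<bar> \<partial>lborel) < \<infinity>"
  shows "AE t in lborel. dyadic_maximal f t < \<infinity>"
proof -
  define e where "e = emeasure lborel {t. dyadic_maximal f t = \<infinity>}"
  obtain I where I: "0 \<le> I" "(\<integral>\<^sup>+ s. ennreal \<bar>f s\<bar> \<partial>lborel) = ennreal I"
    using fin by (cases "\<integral>\<^sup>+ s. ennreal \<bar>f s\<bar> \<partial>lborel") auto
  have bound: "ennreal c * e \<le> 10 * ennreal I" for c
  proof -
    have "ennreal c * e \<le> ennreal c * emeasure lborel {t. ennreal c < dyadic_maximal f t}"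
      unfolding e_def by (intro mult_left_mono emeasure_mono) auto
    also have "\<dots> \<le> 10 * ennreal I"
      using dyadic_maximal_weak_type[of f c] I by simp
    finally show ?thesis .
  qed
  have "e = 0"
  proof (cases e)
    case (real x)
    have "c * x \<le> 10 * I" if "c \<ge> 0" for c
      using bound[of c] real I(1) that
      by (simp add: ennreal_mult'[symmetric] flip: ennreal_numeral)
    from this[of "(10 * I + 1) / x"] show ?thesis using real I
      by (cases "x = 0") auto
  next
    case top
    then show ?thesis using bound[of 1] by (simp add: ennreal_mult_eq_top_iff top_unique)
  qed
  then show ?thesis
    unfolding e_def by (subst AE_iff_measurable[OF _ refl]) (auto simp: less_top[symmetric])
qed

section \<open>The Hardy--Littlewood maximal inequality\<close>

lemma nn_integral_powr_from_0:
  fixes y b :: real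
  assumes "0 < b" "0 \<le> y"
  shows "(\<integral>\<^sup>+ c\<in>{0<..<y}. ennreal (c powr (b - 1)) \<partial>lborel) = ennreal (y powr b / b)"
proof -
  have "(\<integral>\<^sup>+ c\<in>{0<..<y}. ennreal (c powr (b - 1)) \<partial>lborel)
      = (\<integral>\<^sup>+ c\<in>{0..y}. ennreal (c powr (b - 1)) \<partial>lborel)"
    using AE_lborel_singleton[of 0] AE_lborel_singleton[of y]
    by (intro nn_integral_cong_AE) (auto simp: indicator_def)
  also have "\<dots> = ennreal (y powr b / b)"
    using has_integral_powr_from_0[of "b - 1" y] assms
    by (intro nn_integral_has_integral_lebesgue') auto
  finally show ?thesis .
qed

text \<open>
  Discarding the part of \<open>f\<close> of size at most \<open>c\<close> lowers the maximal function by at most \<open>2 * c\<close>,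
  where the factor \<open>2\<close> comes from the normalisation of the windows.
\<close>

lemma dyadic_maximal_le_truncated:
  assumes [measurable]: "f \<in> borel_measurable borel" and "0 \<le> c"
  shows "dyadic_maximal f t
    \<le> dyadic_maximal (\<lambda>s. if c < \<bar>f s\<bar> then f s else 0) t + ennreal (2 * c)"
  unfolding dyadic_maximal_def[of f]
proof (rule SUP_least)
  fix k :: nat
  let ?g = "\<lambda>s. if c < \<bar>f s\<bar> then f s else 0"
  let ?I = "{t - (1/2) ^ k..t + (1/2) ^ k}"
  have "2 ^ k * (\<integral>\<^sup>+ s\<in>?I. ennreal \<bar>f s\<bar> \<partial>lborel)
      \<le> 2 ^ k * (\<integral>\<^sup>+ s. ennreal \<bar>?g s\<bar> * indicator ?I s + ennreal c * indicator ?I s \<partial>lborel)"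
    using assms(2)
    by (intro mult_left_mono nn_integral_mono)
      (auto simp: indicator_def ennreal_plus[symmetric] simp del: ennreal_plus intro!: ennreal_leI)
  also have "\<dots> = 2 ^ k * (\<integral>\<^sup>+ s\<in>?I. ennreal \<bar>?g s\<bar> \<partial>lborel) + 2 ^ k * (ennreal c * emeasure lborel ?I)"
    by (subst nn_integral_add) (auto simp: nn_integral_cmult distrib_left)
  also have "2 ^ k * (ennreal c * emeasure lborel ?I) = (2 ^ k * ennreal ((1/2) ^ k)) * ennreal (2 * c)"
    using assms(2) by (simp add: mult_ac ennreal_mult[symmetric] del: ennreal_power)
  also have "\<dots> = ennreal (2 * c)"
    unfolding pow2_mult_pow_half_ennreal by simp
  also have "2 ^ k * (\<integral>\<^sup>+ s\<in>?I. ennreal \<bar>?g s\<bar> \<partial>lborel) \<le> dyadic_maximal ?g t"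
    by (rule dyadic_maximal_upper)
  finally show "2 ^ k * (\<integral>\<^sup>+ s\<in>?I. ennreal \<bar>f s\<bar> \<partial>lborel) \<le> dyadic_maximal ?g t + ennreal (2 * c)"
    by (simp add: add_right_mono)
qed

text \<open>
  The maximal inequality in \<open>L\<^sub>q\<close> for \<open>q > 1\<close>, stated for a real function \<open>g\<close> dominated by
  the maximal function so that powers are taken of reals only. By the layer cake formula, the left
  side is the integral over \<open>c > 0\<close> of \<open>q * c powr (q - 1)\<close> times the measure of
  \<open>{\<bar>g\<bar> > c}\<close>. Truncation at \<open>c / 4\<close> and the weak type estimate at level \<open>c / 2\<close> bound that
  measure by \<open>20 / c\<close> times the integral of \<open>\<bar>f\<bar>\<close> over \<open>{\<bar>f\<bar> > c / 4}\<close>; exchanging the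
  integrals leaves \<open>c powr (q - 2)\<close>, which is integrable at \<open>0\<close> because \<open>q > 1\<close>.
\<close>

lemma dyadic_maximal_strong_type:
  fixes f g :: "real \<Rightarrow> real"
  assumes [measurable]: "f \<in> borel_measurable borel" "g \<in> borel_measurable borel"
    and q: "1 < q"
    and dom: "AE t in lborel. ennreal \<bar>g t\<bar> \<le> dyadic_maximal f t"
  shows "(\<integral>\<^sup>+ t. ennreal (\<bar>g t\<bar> powr q) \<partial>lborel)
    \<le> ennreal (20 * q * 4 powr (q - 1) / (q - 1)) * (\<integral>\<^sup>+ s. ennreal (\<bar>f s\<bar> powr q) \<partial>lborel)"
proof -
  \<comment> \<open>Makes the indicator visibly measurable jointly in the level and the argument.\<close>
  have ind: "indicator {0<..<y} c = (if 0 < c \<and> c < y then 1 else (0::ennreal))" for y c :: real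
    by (simp add: indicator_def)
  let ?f = "\<lambda>c s. if c / 4 < \<bar>f s\<bar> then f s else 0"
  have level: "ennreal (q * c powr (q - 1)) * emeasure lborel {t. c < \<bar>g t\<bar>}
      \<le> ennreal (20 * q * c powr (q - 2)) * (\<integral>\<^sup>+ s. ennreal \<bar>?f c s\<bar> \<partial>lborel)" if c: "0 < c" for c
  proof -
    have "emeasure lborel {t. c < \<bar>g t\<bar>} \<le> emeasure lborel {t. ennreal (c/2) < dyadic_maximal (?f c) t}"
    proof (rule emeasure_mono_AE)
      show "AE t in lborel. t \<in> {t. c < \<bar>g t\<bar>} \<longrightarrow> t \<in> {t. ennreal (c/2) < dyadic_maximal (?f c) t}"
        using dom
      proof eventually_elim
        case (elim t)
        show ?case
        proof (intro impI, rule ccontr)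
          assume "t \<in> {t. c < \<bar>g t\<bar>}" and "t \<notin> {t. ennreal (c/2) < dyadic_maximal (?f c) t}"
          then have *: "ennreal c < ennreal \<bar>g t\<bar>" "dyadic_maximal (?f c) t \<le> ennreal (c/2)"
            using c by (auto simp: ennreal_less_iff)
          have "ennreal \<bar>g t\<bar> \<le> dyadic_maximal (?f c) t + ennreal (2 * (c/4))"
            using elim dyadic_maximal_le_truncated[OF assms(1), of "c/4" t] c
            by (auto intro: order_trans)
          also have "\<dots> \<le> ennreal (c/2) + ennreal (2 * (c/4))"
            using * by (intro add_right_mono)
          also have "\<dots> = ennreal c"
            using c by (subst ennreal_plus[symmetric]) auto
          finally show False using *(1) by simp
        qed
      qed
    qed measurable
    then have "ennreal (c/2) * emeasure lborel {t. c < \<bar>g t\<bar>}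
        \<le> ennreal (c/2) * emeasure lborel {t. ennreal (c/2) < dyadic_maximal (?f c) t}"
      by (intro mult_left_mono) auto
    also have "\<dots> \<le> 10 * (\<integral>\<^sup>+ s. ennreal \<bar>?f c s\<bar> \<partial>lborel)"
      by (rule dyadic_maximal_weak_type) measurable
    finally have "ennreal (2 * q * c powr (q - 2)) * (ennreal (c/2) * emeasure lborel {t. c < \<bar>g t\<bar>})
        \<le> ennreal (2 * q * c powr (q - 2)) * (10 * (\<integral>\<^sup>+ s. ennreal \<bar>?f c s\<bar> \<partial>lborel))"
      by (intro mult_left_mono) auto
    moreover have "ennreal (2 * q * c powr (q - 2)) * ennreal (c/2) = ennreal (q * c powr (q - 1))"
    proof -
      have "c powr (q - 1) = c powr (q - 2) * c powr 1"
        by (subst powr_add[symmetric]) simp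
      then show ?thesis using c q
        by (subst ennreal_mult[symmetric]) (auto simp: field_simps)
    qed
    moreover have "ennreal (2 * q * c powr (q - 2)) * 10 = ennreal (20 * q * c powr (q - 2))"
      using q ennreal_mult''[of 10 "2 * q * c powr (q - 2)"] by (simp add: mult_ac)
    ultimately show ?thesis by (simp only: mult.assoc[symmetric])
  qed
  have "(\<integral>\<^sup>+ t. ennreal (\<bar>g t\<bar> powr q) \<partial>lborel)
      = (\<integral>\<^sup>+ t. ennreal q * (\<integral>\<^sup>+ c\<in>{0<..<\<bar>g t\<bar>}. ennreal (c powr (q - 1)) \<partial>lborel) \<partial>lborel)"
    using q by (intro nn_integral_cong) (simp add: nn_integral_powr_from_0 ennreal_mult[symmetric])
  also have "\<dots> = (\<integral>\<^sup>+ t. (\<integral>\<^sup>+ c. ennreal (q * c powr (q - 1)) * indicator {0<..<\<bar>g t\<bar>} c \<partial>lborel) \<partial>lborel)"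
    using q by (intro nn_integral_cong, subst nn_integral_cmult[symmetric])
      (auto simp: ennreal_mult mult_ac)
  also have "\<dots> = (\<integral>\<^sup>+ c. (\<integral>\<^sup>+ t. ennreal (q * c powr (q - 1)) * indicator {0<..<\<bar>g t\<bar>} c \<partial>lborel) \<partial>lborel)"
    unfolding ind by (rule lborel_pair.Fubini') measurable
  also have "\<dots> \<le> (\<integral>\<^sup>+ c. (\<integral>\<^sup>+ s. ennreal (20 * q * c powr (q - 2)) * ennreal \<bar>f s\<bar> * indicator {0<..<4 * \<bar>f s\<bar>} c \<partial>lborel) \<partial>lborel)"
  proof (rule nn_integral_mono)
    fix c :: real
    show "(\<integral>\<^sup>+ t. ennreal (q * c powr (q - 1)) * indicator {0<..<\<bar>g t\<bar>} c \<partial>lborel)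
      \<le> (\<integral>\<^sup>+ s. ennreal (20 * q * c powr (q - 2)) * ennreal \<bar>f s\<bar> * indicator {0<..<4 * \<bar>f s\<bar>} c \<partial>lborel)"
    proof (cases "0 < c")
      case True
      have "(\<integral>\<^sup>+ t. ennreal (q * c powr (q - 1)) * indicator {0<..<\<bar>g t\<bar>} c \<partial>lborel)
          = (\<integral>\<^sup>+ t. ennreal (q * c powr (q - 1)) * indicator {t. c < \<bar>g t\<bar>} t \<partial>lborel)"
        using True by (intro nn_integral_cong) (auto simp: indicator_def)
      also have "\<dots> = ennreal (q * c powr (q - 1)) * emeasure lborel {t. c < \<bar>g t\<bar>}"
        by (rule nn_integral_cmult_indicator) measurable
      also note level[OF True]
      also have "ennreal (20 * q * c powr (q - 2)) * (\<integral>\<^sup>+ s. ennreal \<bar>?f c s\<bar> \<partial>lborel)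
          = (\<integral>\<^sup>+ s. ennreal (20 * q * c powr (q - 2)) * ennreal \<bar>?f c s\<bar> \<partial>lborel)"
        by (rule nn_integral_cmult[symmetric]) measurable
      also have "\<dots> = (\<integral>\<^sup>+ s. ennreal (20 * q * c powr (q - 2)) * ennreal \<bar>f s\<bar> * indicator {0<..<4 * \<bar>f s\<bar>} c \<partial>lborel)"
        using True by (intro nn_integral_cong) (auto simp: indicator_def)
      finally show ?thesis .
    qed simp
  qed
  also have "\<dots> = (\<integral>\<^sup>+ s. (\<integral>\<^sup>+ c. ennreal (20 * q * c powr (q - 2)) * ennreal \<bar>f s\<bar> * indicator {0<..<4 * \<bar>f s\<bar>} c \<partial>lborel) \<partial>lborel)"
    unfolding ind by (rule lborel_pair.Fubini') measurable
  also have "\<dots> = (\<integral>\<^sup>+ s. ennreal (20 * q * 4 powr (q - 1) / (q - 1)) * ennreal (\<bar>f s\<bar> powr q) \<partial>lborel)"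
  proof (rule nn_integral_cong)
    fix s :: real
    have "(\<integral>\<^sup>+ c. ennreal (20 * q * c powr (q - 2)) * ennreal \<bar>f s\<bar> * indicator {0<..<4 * \<bar>f s\<bar>} c \<partial>lborel)
        = ennreal (20 * q * \<bar>f s\<bar>) * (\<integral>\<^sup>+ c\<in>{0<..<4 * \<bar>f s\<bar>}. ennreal (c powr ((q - 1) - 1)) \<partial>lborel)"
      using q by (subst nn_integral_cmult[symmetric]) (auto simp: ennreal_mult mult_ac)
    also have "\<dots> = ennreal (20 * q * \<bar>f s\<bar> * ((4 * \<bar>f s\<bar>) powr (q - 1) / (q - 1)))"
      using q by (subst nn_integral_powr_from_0) (auto simp: ennreal_mult[symmetric])
    also have "20 * q * \<bar>f s\<bar> * ((4 * \<bar>f s\<bar>) powr (q - 1) / (q - 1))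
        = 20 * q * 4 powr (q - 1) / (q - 1) * \<bar>f s\<bar> powr q"
    proof -
      have "\<bar>f s\<bar> powr q = \<bar>f s\<bar> powr 1 * \<bar>f s\<bar> powr (q - 1)"
        by (subst powr_add[symmetric]) simp
      then show ?thesis by (simp add: powr_mult field_simps)
    qed
    also have "ennreal \<dots> = ennreal (20 * q * 4 powr (q - 1) / (q - 1)) * ennreal (\<bar>f s\<bar> powr q)"
      using q by (intro ennreal_mult) auto
    finally show "(\<integral>\<^sup>+ c. ennreal (20 * q * c powr (q - 2)) * ennreal \<bar>f s\<bar> * indicator {0<..<4 * \<bar>f s\<bar>} c \<partial>lborel)
        = ennreal (20 * q * 4 powr (q - 1) / (q - 1)) * ennreal (\<bar>f s\<bar> powr q)" .
  qed
  also have "\<dots> = ennreal (20 * q * 4 powr (q - 1) / (q - 1)) * (\<integral>\<^sup>+ s. ennreal (\<bar>f s\<bar> powr q) \<partial>lborel)"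
    by (rule nn_integral_cmult) measurable
  finally show ?thesis .
qed

section \<open>A constant independent of the order\<close>

text \<open>
  A minimum exists on \<open>{1..2}\<close> by compactness; beyond \<open>2\<close> the functional equation
  \<open>Gamma x = (x - 1) * Gamma (x - 1)\<close> has a factor at least \<open>1\<close>.
\<close>

lemma Gamma_real_lower_bound: "\<exists>c>0. \<forall>x\<ge>1. c \<le> Gamma (x::real)"
proof -
  have "continuous_on {1..2} (Gamma :: real \<Rightarrow> real)"
    by (rule continuous_on_Gamma) (auto elim!: nonpos_Ints_cases)
  then obtain x0 where x0: "x0 \<in> {1..2}" "\<And>x. x \<in> {1..2} \<Longrightarrow> Gamma x0 \<le> Gamma (x::real)"
    using continuous_attains_inf[of "{1..2::real}" Gamma] by auto
  have "\<forall>x. 1 \<le> x \<and> x \<le> real n + 2 \<longrightarrow> Gamma x0 \<le> Gamma x" for n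
  proof (induction n)
    case 0
    then show ?case using x0 by auto
  next
    case (Suc n)
    show ?case
    proof (intro allI impI)
      fix x :: real assume x: "1 \<le> x \<and> x \<le> real (Suc n) + 2"
      show "Gamma x0 \<le> Gamma x"
      proof (cases "x \<le> 2")
        case True
        then show ?thesis using x x0 by auto
      next
        case False
        have "Gamma (x - 1 + 1) = (x - 1) * Gamma (x - 1)"
          using False by (intro Gamma_plus1) (auto elim!: nonpos_Ints_cases)
        moreover have "1 * Gamma (x - 1) \<le> (x - 1) * Gamma (x - 1)"
          using False by (intro mult_right_mono) (auto simp: less_imp_le)
        ultimately have "Gamma (x - 1) \<le> Gamma x" by simp
        moreover have "Gamma x0 \<le> Gamma (x - 1)" using Suc x False by auto
        ultimately show ?thesis by simp
      qed
    qed
  qed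
  moreover have "\<exists>n. x \<le> real n + 2" for x :: real
    using real_arch_simple[of "x - 2"] by (auto simp: algebra_simps)
  ultimately have "\<forall>x\<ge>1. Gamma x0 \<le> Gamma x" by blast
  moreover have "Gamma x0 > 0" using x0(1) by (intro Gamma_real_pos) auto
  ultimately show ?thesis by blast
qed

text \<open>
  For \<open>a \<ge> 1\<close> both factors are bounded. For \<open>a < 1\<close> the first is at most \<open>8 / a\<close>, because
  \<open>2 powr a \<ge> 1 + a / 2\<close>, and the second is \<open>a / Gamma (a + 1)\<close>.
\<close>

lemma RL_constant_bound:
  "\<exists>C>0. \<forall>a>0. 2 / (1 - 2 powr - a) * (1 / Gamma a) \<le> (C::real)"
proof -
  obtain c where c: "c > 0" "\<And>x. x \<ge> 1 \<Longrightarrow> c \<le> Gamma (x::real)"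
    using Gamma_real_lower_bound by auto
  have "2 / (1 - 2 powr - a) * (1 / Gamma a) \<le> 8 / c" if a: "a > 0" for a
  proof (cases "a \<ge> 1")
    case True
    have "2 powr - a \<le> (2::real) powr - 1" using True by (intro powr_mono) auto
    then have "2 / (1 - 2 powr - a) \<le> 8" by (simp add: powr_minus field_simps)
    moreover have "1 / Gamma a \<le> 1 / c" using c True by (intro divide_left_mono mult_pos_pos) auto
    ultimately have "2 / (1 - 2 powr - a) * (1 / Gamma a) \<le> 8 * (1 / c)"
      using a by (intro mult_mono) auto
    then show ?thesis by simp
  next
    case False
    have "1 + a / 2 \<le> 1 + a * ln 2"
      using a ln2_ge_two_thirds by simp
    also have "\<dots> \<le> exp (a * ln 2)" by (rule exp_ge_add_one_self)
    also have "\<dots> = 2 powr a" by (simp add: powr_def)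
    finally have "2 powr - a \<le> 1 / (1 + a / 2)"
      unfolding powr_minus_divide using a by (intro divide_left_mono mult_pos_pos) auto
    also have "\<dots> \<le> 1 - a / 4"
      using a False by (simp add: field_simps power2_eq_square)
    finally have 1: "a / 4 \<le> 1 - 2 powr - a" by simp
    have "c \<le> Gamma (a + 1)" using c a by simp
    also have "\<dots> = a * Gamma a"
      using a by (intro Gamma_plus1) (auto elim!: nonpos_Ints_cases)
    finally have 2: "1 / Gamma a \<le> a / c"
      using c(1) a by (simp add: field_simps)
    have "2 / (1 - 2 powr - a) \<le> 2 / (a / 4)"
      using 1 a by (intro divide_left_mono mult_pos_pos) auto
    then have "2 / (1 - 2 powr - a) * (1 / Gamma a) \<le> 2 / (a / 4) * (a / c)"
      using 2 a c(1) by (intro mult_mono) (auto simp: less_imp_le)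
    then show ?thesis using a by simp
  qed
  then show ?thesis using c(1) by (intro exI[of _ "8 / c"]) auto
qed

section \<open>Pointwise domination by the maximal function\<close>

text \<open>
  Only the term with \<open>2 powr (- k - 1) < x \<le> 2 powr - k\<close> is used. The factor \<open>2\<close> is needed for
  \<open>a < 1\<close>, where the kernel is decreasing and its value at the left end of the shell is up to
  twice that at the right end.
\<close>

lemma powr_le_dyadic_sum:
  fixes a x :: real
  assumes x: "0 < x" "x \<le> 1" and a: "0 < a"
  shows "ennreal (x powr (a - 1))
    \<le> (\<Sum>k. ennreal (2 * (2 powr - a) ^ k) * (2 ^ k * indicator {..(1/2) ^ k} x))"
proof -
  obtain n where n: "(1/2) ^ n < x" "\<And>m. (1/2) ^ m < x \<Longrightarrow> n \<le> m"
    using real_arch_pow_inv[OF x(1), of "1/2"] exists_least_iff[of "\<lambda>n. (1/2) ^ n < x"]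
    by (metis (no_types, lifting) leI one_less_numeral_iff semiring_norm(76) divide_less_eq_1_pos zero_less_numeral)
  define k where "k = n - 1"
  have "n \<noteq> 0" using n(1) x by (intro notI) auto
  then have nk: "n = Suc k" by (simp add: k_def)
  define r :: real where "r = (1/2) ^ k"
  have r: "0 < r" "x \<le> r" "r / 2 < x"
    using n(1) n(2)[of k] nk by (auto simp: r_def not_less[symmetric])
  have rp: "(2 powr - a) ^ k * 2 ^ k = r powr (a - 1)"
  proof -
    have r2: "r = 2 powr - real k"
      by (simp add: r_def powr_minus powr_realpow power_one_over field_simps)
    have "(2 powr - a) ^ k * 2 ^ k = (2 powr - a) powr real k * 2 powr real k"
      by (simp add: powr_realpow)
    also have "\<dots> = r powr (a - 1)"
      unfolding r2 powr_powr by (simp add: powr_add[symmetric] algebra_simps)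
    finally show ?thesis .
  qed
  have "x powr (a - 1) \<le> 2 * r powr (a - 1)"
  proof (cases "a \<ge> 1")
    case True
    then have "x powr (a - 1) \<le> r powr (a - 1)"
      using r x by (intro powr_mono2) auto
    then show ?thesis using r(1) by (smt (verit) powr_ge_zero)
  next
    case False
    have "x powr (a - 1) \<le> (r / 2) powr (a - 1)"
      using False r x by (intro powr_mono2') auto
    also have "\<dots> = r powr (a - 1) * 2 powr (1 - a)"
      using r(1) by (simp add: powr_divide powr_diff field_simps)
    also have "\<dots> \<le> r powr (a - 1) * 2 powr 1"
      using a by (intro mult_left_mono powr_mono) auto
    finally show ?thesis by (simp add: mult_ac)
  qed
  also have "2 * r powr (a - 1) = 2 * (2 powr - a) ^ k * 2 ^ k"
    using rp by simp
  finally have "ennreal (x powr (a - 1)) \<le> ennreal (2 * (2 powr - a) ^ k * 2 ^ k)"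
    by (rule ennreal_leI)
  also have "\<dots> = ennreal (2 * (2 powr - a) ^ k) * (2 ^ k * indicator {..(1/2) ^ k} x)"
    using r(2) by (subst ennreal_mult) (auto simp: r_def simp flip: ennreal_power)
  also have "\<dots> = (\<Sum>j\<in>{k}. ennreal (2 * (2 powr - a) ^ j) * (2 ^ j * indicator {..(1/2) ^ j} x))"
    by simp
  also have "\<dots> \<le> (\<Sum>j. ennreal (2 * (2 powr - a) ^ j) * (2 ^ j * indicator {..(1/2) ^ j} x))"
    by (rule sum_le_suminf) auto
  finally show ?thesis .
qed

lemma nn_integral_RL_integrand_le:
  assumes [measurable]: "f \<in> borel_measurable borel" and t: "t \<le> 1" and a: "0 < \<alpha> t"
  shows "(\<integral>\<^sup>+ s\<in>{0..t}. ennreal \<bar>RL_integrand \<alpha> f t s\<bar> \<partial>lborel)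
    \<le> ennreal (2 / (1 - 2 powr - \<alpha> t)) * dyadic_maximal f t"
proof -
  define q :: real where "q = 2 powr - \<alpha> t"
  have q: "0 < q" "q < 1"
    using a powr_less_mono[of "- \<alpha> t" 0 2] by (auto simp: q_def)
  let ?I = "\<lambda>k. {t - (1/2) ^ k..t + (1/2::real) ^ k}"
  have "(\<integral>\<^sup>+ s\<in>{0..t}. ennreal \<bar>RL_integrand \<alpha> f t s\<bar> \<partial>lborel)
      \<le> (\<integral>\<^sup>+ s. (\<Sum>k. ennreal (2 * q ^ k) * (2 ^ k * (ennreal \<bar>f s\<bar> * indicator (?I k) s))) \<partial>lborel)"
  proof (rule nn_integral_mono)
    fix s :: real
    show "ennreal \<bar>RL_integrand \<alpha> f t s\<bar> * indicator {0..t} s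
      \<le> (\<Sum>k. ennreal (2 * q ^ k) * (2 ^ k * (ennreal \<bar>f s\<bar> * indicator (?I k) s)))"
    proof (cases "0 \<le> s \<and> s < t")
      case True
      have "ennreal \<bar>RL_integrand \<alpha> f t s\<bar> = ennreal ((t - s) powr (\<alpha> t - 1)) * ennreal \<bar>f s\<bar>"
        by (simp add: RL_integrand_def abs_mult ennreal_mult')
      also have "\<dots> \<le> (\<Sum>k. ennreal (2 * q ^ k) * (2 ^ k * indicator {..(1/2) ^ k} (t - s))) * ennreal \<bar>f s\<bar>"
        unfolding q_def using True t a by (intro mult_right_mono powr_le_dyadic_sum) auto
      also have "\<dots> = (\<Sum>k. ennreal (2 * q ^ k) * (2 ^ k * indicator {..(1/2) ^ k} (t - s)) * ennreal \<bar>f s\<bar>)"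
        by (rule ennreal_suminf_multc[symmetric])
      also have "\<dots> = (\<Sum>k. ennreal (2 * q ^ k) * (2 ^ k * (ennreal \<bar>f s\<bar> * indicator (?I k) s)))"
      proof (rule suminf_cong)
        fix k
        have "0 < (1/2::real) ^ k" by simp
        then have "indicator {..(1/2) ^ k} (t - s) = (indicator (?I k) s :: ennreal)"
          using True by (auto simp: indicator_def)
        then show "ennreal (2 * q ^ k) * (2 ^ k * indicator {..(1/2) ^ k} (t - s)) * ennreal \<bar>f s\<bar>
          = ennreal (2 * q ^ k) * (2 ^ k * (ennreal \<bar>f s\<bar> * indicator (?I k) s))"
          by (simp add: mult_ac)
      qed
      finally show ?thesis using True by simp
    next
      case False
      then show ?thesis by (cases "s = t") (auto simp: RL_integrand_def)
    qed
  qed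
  also have "\<dots> = (\<Sum>k. \<integral>\<^sup>+ s. ennreal (2 * q ^ k) * (2 ^ k * (ennreal \<bar>f s\<bar> * indicator (?I k) s)) \<partial>lborel)"
    by (rule nn_integral_suminf) measurable
  also have "\<dots> = (\<Sum>k. ennreal (2 * q ^ k) * (2 ^ k * (\<integral>\<^sup>+ s\<in>?I k. ennreal \<bar>f s\<bar> \<partial>lborel)))"
    by (simp add: nn_integral_cmult)
  also have "\<dots> \<le> (\<Sum>k. ennreal (2 * q ^ k) * dyadic_maximal f t)"
    by (intro suminf_le mult_left_mono dyadic_maximal_upper) auto
  also have "\<dots> = (\<Sum>k. ennreal (2 * q ^ k)) * dyadic_maximal f t"
    by (rule ennreal_suminf_multc)
  also have "(\<Sum>k. ennreal (2 * q ^ k)) = ennreal (2 / (1 - q))"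
    using q sums_mult[OF geometric_sums[of q], of 2] by (intro suminf_ennreal_eq) auto
  finally show ?thesis unfolding q_def .
qed

lemma set_integrable_RL_integrand:
  assumes [measurable]: "f \<in> borel_measurable borel" and "t \<le> 1" "0 < \<alpha> t"
    and "dyadic_maximal f t < \<infinity>"
  shows "set_integrable lebesgue {0..t} (RL_integrand \<alpha> f t)"
proof -
  have m: "(\<lambda>s. indicator {0..t} s *\<^sub>R RL_integrand \<alpha> f t s) \<in> borel_measurable borel"
    unfolding RL_integrand_def by measurable
  have "(\<integral>\<^sup>+ s. ennreal (norm (indicator {0..t} s *\<^sub>R RL_integrand \<alpha> f t s)) \<partial>lborel)
      = (\<integral>\<^sup>+ s\<in>{0..t}. ennreal \<bar>RL_integrand \<alpha> f t s\<bar> \<partial>lborel)"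
    by (intro nn_integral_cong) (auto simp: indicator_def)
  also have "\<dots> \<le> ennreal (2 / (1 - 2 powr - \<alpha> t)) * dyadic_maximal f t"
    by (rule nn_integral_RL_integrand_le) fact+
  also have "\<dots> < \<infinity>"
    using assms(4) by (simp add: ennreal_mult_less_top less_top)
  finally have "integrable lborel (\<lambda>s. indicator {0..t} s *\<^sub>R RL_integrand \<alpha> f t s)"
    using m by (intro integrableI_bounded) auto
  then show ?thesis
    unfolding set_integrable_def using m by (subst integrable_completion) auto
qed

lemma RL_operator_le_dyadic_maximal:
  assumes [measurable]: "f \<in> borel_measurable borel" and t: "t \<le> 1" "0 < \<alpha> t"
    and C: "2 / (1 - 2 powr - \<alpha> t) * (1 / Gamma (\<alpha> t)) \<le> C"
  shows "ennreal \<bar>RL_operator \<alpha> f t\<bar> \<le> ennreal C * dyadic_maximal f t"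
proof -
  let ?h = "\<lambda>s. indicator {0..t} s *\<^sub>R RL_integrand \<alpha> f t s"
  have G: "0 < Gamma (\<alpha> t)" using t(2) by (rule Gamma_real_pos)
  have "ennreal (norm (integral\<^sup>L lebesgue ?h)) \<le> (\<integral>\<^sup>+ s. ennreal (norm (?h s)) \<partial>lebesgue)"
  proof (cases "integrable lebesgue ?h")
    case True
    then show ?thesis by (rule integral_norm_bound_ennreal)
  qed (simp add: not_integrable_integral_eq)
  also have "\<dots> = (\<integral>\<^sup>+ s\<in>{0..t}. ennreal \<bar>RL_integrand \<alpha> f t s\<bar> \<partial>lborel)"
    unfolding nn_integral_completion by (intro nn_integral_cong) (auto simp: indicator_def)
  also have "\<dots> \<le> ennreal (2 / (1 - 2 powr - \<alpha> t)) * dyadic_maximal f t"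
    by (rule nn_integral_RL_integrand_le) fact+
  finally have "ennreal (1 / Gamma (\<alpha> t)) * ennreal (norm (integral\<^sup>L lebesgue ?h))
      \<le> ennreal (1 / Gamma (\<alpha> t)) * (ennreal (2 / (1 - 2 powr - \<alpha> t)) * dyadic_maximal f t)"
    by (intro mult_left_mono) auto
  also have "\<dots> = ennreal (2 / (1 - 2 powr - \<alpha> t) * (1 / Gamma (\<alpha> t))) * dyadic_maximal f t"
    using G by (subst ennreal_mult'') (auto simp: mult_ac)
  also have "\<dots> \<le> ennreal C * dyadic_maximal f t"
    using C by (intro mult_right_mono ennreal_leI) auto
  also have "ennreal (1 / Gamma (\<alpha> t)) * ennreal (norm (integral\<^sup>L lebesgue ?h))
      = ennreal \<bar>RL_operator \<alpha> f t\<bar>"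
    using G by (subst ennreal_mult'[symmetric])
      (auto simp: RL_operator_def set_lebesgue_integral_def abs_mult)
  finally show ?thesis .
qed

section \<open>Passage to Borel representatives\<close>

lemma borel_measurable_RL_operator:
  assumes [measurable]: "f \<in> borel_measurable borel" "\<alpha> \<in> borel_measurable borel"
  shows "RL_operator \<alpha> f \<in> borel_measurable borel"
proof -
  \<comment> \<open>The reciprocal Gamma function is entire, hence continuous also at the poles of Gamma.\<close>
  have [measurable]: "(rGamma :: real \<Rightarrow> real) \<in> borel_measurable borel"
    by (rule borel_measurable_continuous_onI) (rule continuous_on_rGamma)
  have "RL_operator \<alpha> f t = rGamma (\<alpha> t) *
      (LINT s|lborel. (if 0 \<le> s \<and> s \<le> t then (t - s) powr (\<alpha> t - 1) * f s else 0))" for t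
  proof -
    have "(LINT s|lebesgue. indicator {0..t} s *\<^sub>R ((t - s) powr (\<alpha> t - 1) * f s))
        = (LINT s|lborel. indicator {0..t} s *\<^sub>R ((t - s) powr (\<alpha> t - 1) * f s))"
      by (rule integral_completion) measurable
    also have "\<dots> = (LINT s|lborel. (if 0 \<le> s \<and> s \<le> t then (t - s) powr (\<alpha> t - 1) * f s else 0))"
      by (intro Bochner_Integration.integral_cong) (auto simp: indicator_def)
    finally show ?thesis
      by (simp add: RL_operator_def RL_integrand_def set_lebesgue_integral_def
          rGamma_inverse_Gamma inverse_eq_divide)
  qed
  then have "RL_operator \<alpha> f = (\<lambda>t. rGamma (\<alpha> t) *
      (LINT s|lborel. (if 0 \<le> s \<and> s \<le> t then (t - s) powr (\<alpha> t - 1) * f s else 0)))" ..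
  also have "\<dots> \<in> borel_measurable borel" by measurable
  finally show ?thesis .
qed

lemma AE_unit_interval_iff:
  "(AE x in unit_interval_measure. P x) \<longleftrightarrow> (AE x in lborel. x \<in> {0..1} \<longrightarrow> P x)"
  by (subst AE_restrict_space_iff) (auto simp: AE_completion_iff)

text \<open>
  The representative is extended by zero outside the unit interval, so that integrals over the line
  and over the unit interval agree.
\<close>

lemma unit_interval_borel_version:
  fixes h :: "real \<Rightarrow> real"
  assumes "h \<in> borel_measurable unit_interval_measure"
  obtains h' where "h' \<in> borel_measurable borel" "\<And>x. x \<notin> {0..1} \<Longrightarrow> h' x = 0"
    "AE x in lborel. x \<in> {0..1} \<longrightarrow> h x = h' x"
proof -
  have "(\<lambda>x. indicat_real {0..1} x *\<^sub>R h x) \<in> borel_measurable (completion lborel)"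
    using assms by (subst (asm) borel_measurable_restrict_space_iff) auto
  from completion_ex_borel_measurable_real[OF this]
  obtain g where g: "g \<in> borel_measurable lborel" "AE x in lborel. indicat_real {0..1} x *\<^sub>R h x = g x"
    by blast
  have [measurable]: "g \<in> borel_measurable borel" using g(1) by simp
  show thesis
  proof (rule that)
    show "(\<lambda>x. indicator {0..1} x * g x) \<in> borel_measurable borel" by measurable
    show "AE x in lborel. x \<in> {0..1} \<longrightarrow> h x = indicator {0..1} x * g x"
      using g(2) by eventually_elim auto
  qed auto
qed

lemma measurable_RL_integrand:
  assumes "f \<in> borel_measurable unit_interval_measure" "t \<le> 1"
  shows "(\<lambda>s. indicator {0..t} s *\<^sub>R RL_integrand \<alpha> f t s) \<in> borel_measurable lebesgue"
proof -
  have [measurable]: "(\<lambda>x. indicat_real {0..1} x *\<^sub>R f x) \<in> borel_measurable lebesgue"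
    using assms by (subst (asm) borel_measurable_restrict_space_iff) auto
  have [measurable]: "(\<lambda>s. indicat_real {0..t} s * (t - s) powr (\<alpha> t - 1)) \<in> borel_measurable lebesgue"
    by (rule measurable_completion) measurable
  have "(\<lambda>s. indicator {0..t} s *\<^sub>R RL_integrand \<alpha> f t s)
      = (\<lambda>s. (indicator {0..t} s * (t - s) powr (\<alpha> t - 1)) * (indicat_real {0..1} s *\<^sub>R f s))"
    using assms(2) by (auto simp: RL_integrand_def indicator_def fun_eq_iff)
  also have "\<dots> \<in> borel_measurable lebesgue" by measurable
  finally show ?thesis .
qed

lemma RL_integrand_AE_cong:
  assumes "AE x in lborel. x \<in> {0..1} \<longrightarrow> f x = g x" "t \<le> 1" "\<alpha> t = \<beta> t"
  shows "AE s in lebesgue. indicat_real {0..t} s *\<^sub>R RL_integrand \<alpha> f t s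
    = indicat_real {0..t} s *\<^sub>R RL_integrand \<beta> g t s"
proof -
  have "AE s in lborel. indicat_real {0..t} s *\<^sub>R RL_integrand \<alpha> f t s
    = indicat_real {0..t} s *\<^sub>R RL_integrand \<beta> g t s"
    using assms(1) by eventually_elim (use assms(2,3) in \<open>auto simp: RL_integrand_def indicator_def\<close>)
  then show ?thesis by (rule AE_completion)
qed

text \<open>
  The value at \<open>t\<close> depends only on the class of \<open>f\<close> modulo null sets and on the number \<open>\<alpha> t\<close>.
\<close>

lemma RL_operator_AE_cong:
  assumes "f \<in> borel_measurable unit_interval_measure" "g \<in> borel_measurable unit_interval_measure"
    and "AE x in lborel. x \<in> {0..1} \<longrightarrow> f x = g x" "t \<le> 1" "\<alpha> t = \<beta> t"
  shows "RL_operator \<alpha> f t = RL_operator \<beta> g t"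
    and "set_integrable lebesgue {0..t} (RL_integrand \<alpha> f t)
      \<longleftrightarrow> set_integrable lebesgue {0..t} (RL_integrand \<beta> g t)"
proof -
  note m = measurable_RL_integrand[OF assms(1,4)] measurable_RL_integrand[OF assms(2,4)]
  note ae = RL_integrand_AE_cong[of f g t \<alpha> \<beta>, OF assms(3-5)]
  show "RL_operator \<alpha> f t = RL_operator \<beta> g t"
    unfolding RL_operator_def set_lebesgue_integral_def
    using integral_cong_AE[OF m(1) m(2) ae] assms(5) by simp
  show "set_integrable lebesgue {0..t} (RL_integrand \<alpha> f t)
      \<longleftrightarrow> set_integrable lebesgue {0..t} (RL_integrand \<beta> g t)"
    unfolding set_integrable_def using integrable_cong_AE[OF m(1) m(2) ae] .
qed

lemma borel_imp_unit_interval_measurable: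
  "f \<in> borel_measurable borel \<Longrightarrow> f \<in> borel_measurable unit_interval_measure"
  by (intro measurable_restrict_space1 measurable_completion) simp

text \<open>
  All that the norm estimates need: Borel representatives \<open>f'\<close> of \<open>f\<close> and \<open>g\<close> of its image, and
  the domination of \<open>g\<close> by the maximal function of \<open>f'\<close>.
\<close>

lemma RL_operator_borel_version:
  assumes vo: "variable_order \<alpha>" and f: "f \<in> borel_measurable unit_interval_measure"
    and C: "\<And>a. a > 0 \<Longrightarrow> 2 / (1 - 2 powr - a) * (1 / Gamma a) \<le> C"
  obtains f' g where "f' \<in> borel_measurable borel" "g \<in> borel_measurable borel"
    "\<forall>x. x \<notin> {0..1} \<longrightarrow> f' x = 0" "AE x in lborel. x \<in> {0..1} \<longrightarrow> f x = f' x"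
    "AE t in lborel. t \<in> {0..1} \<longrightarrow> RL_operator \<alpha> f t = g t
       \<and> ennreal \<bar>g t\<bar> \<le> ennreal C * dyadic_maximal f' t
       \<and> (dyadic_maximal f' t < \<infinity> \<longrightarrow> set_integrable lebesgue {0..t} (RL_integrand \<alpha> f t))"
proof -
  obtain f' where f': "f' \<in> borel_measurable borel" "\<And>x. x \<notin> {0..1} \<Longrightarrow> f' x = 0"
      "AE x in lborel. x \<in> {0..1} \<longrightarrow> f x = f' x"
    using unit_interval_borel_version[OF f] by metis
  obtain a where a: "a \<in> borel_measurable borel" "AE x in lborel. x \<in> {0..1} \<longrightarrow> \<alpha> x = a x"
    using vo unit_interval_borel_version[of \<alpha>] unfolding variable_order_def by metis
  have pos: "AE x in lborel. x \<in> {0..1} \<longrightarrow> 0 < \<alpha> x"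
    using vo unfolding variable_order_def AE_unit_interval_iff by simp
  have "AE t in lborel. t \<in> {0..1} \<longrightarrow> RL_operator \<alpha> f t = RL_operator a f' t
       \<and> ennreal \<bar>RL_operator a f' t\<bar> \<le> ennreal C * dyadic_maximal f' t
       \<and> (dyadic_maximal f' t < \<infinity> \<longrightarrow> set_integrable lebesgue {0..t} (RL_integrand \<alpha> f t))"
    using a(2) pos
  proof eventually_elim
    case (elim t)
    show ?case
    proof
      assume t: "t \<in> {0..1}"
      then have eq: "\<alpha> t = a t" "0 < a t" "t \<le> 1" using elim by auto
      note cong = RL_operator_AE_cong[of f f' t \<alpha> a, OF f borel_imp_unit_interval_measurable[OF f'(1)] f'(3) eq(3,1)]
      show "RL_operator \<alpha> f t = RL_operator a f' t
         \<and> ennreal \<bar>RL_operator a f' t\<bar> \<le> ennreal C * dyadic_maximal f' t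
         \<and> (dyadic_maximal f' t < \<infinity> \<longrightarrow> set_integrable lebesgue {0..t} (RL_integrand \<alpha> f t))"
        unfolding cong using RL_operator_le_dyadic_maximal[of f' t a, OF f'(1) eq(3,2) C[OF eq(2)]]
          set_integrable_RL_integrand[of f' t a, OF f'(1) eq(3,2)] by simp
    qed
  qed
  then show thesis
    using that[OF f'(1) borel_measurable_RL_operator[OF f'(1) a(1)] _ f'(3)] f'(2) by blast
qed

lemma unit_interval_measurable_AE_cong:
  fixes f g :: "real \<Rightarrow> real"
  assumes "g \<in> borel_measurable unit_interval_measure" "AE x in unit_interval_measure. f x = g x"
  shows "f \<in> borel_measurable unit_interval_measure"
proof -
  have "(\<lambda>x. indicat_real {0..1} x *\<^sub>R g x) \<in> borel_measurable lebesgue"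
    using assms(1) by (subst (asm) borel_measurable_restrict_space_iff) auto
  moreover have "AE x in lebesgue. indicat_real {0..1} x *\<^sub>R g x = indicat_real {0..1} x *\<^sub>R f x"
    using assms(2) unfolding AE_unit_interval_iff
    by (intro AE_completion) (auto elim!: eventually_mono simp: indicator_def)
  ultimately have "(\<lambda>x. indicat_real {0..1} x *\<^sub>R f x) \<in> borel_measurable lebesgue"
    by (rule borel_measurable_AE)
  then show ?thesis by (subst borel_measurable_restrict_space_iff) auto
qed

section \<open>Norm estimates\<close>

lemma RL_operator_L_infinity:
  assumes vo: "variable_order \<alpha>" and f: "f \<in> Lp_space \<infinity> unit_interval_measure"
    and C: "\<And>a. a > 0 \<Longrightarrow> 2 / (1 - 2 powr - a) * (1 / Gamma a) \<le> C" "C > 0"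
  shows "AE t in unit_interval_measure. set_integrable lebesgue {0..t} (RL_integrand \<alpha> f t)"
    and "RL_operator \<alpha> f \<in> Lp_space \<infinity> unit_interval_measure"
    and "Lp_norm \<infinity> unit_interval_measure (RL_operator \<alpha> f)
      \<le> 2 * C * Lp_norm \<infinity> unit_interval_measure f"
proof -
  let ?U = unit_interval_measure
  let ?ess = "\<lambda>h. esssup ?U (\<lambda>x. ereal \<bar>h x\<bar>)"
  define N where "N = real_of_ereal (?ess f)"
  have fm: "f \<in> borel_measurable ?U" and ffin: "?ess f < \<infinity>"
    using f by (auto simp: Lp_space_def)
  have U: "emeasure ?U (space ?U) \<noteq> 0"
    by (simp add: emeasure_restrict_space)
  have nonneg: "0 \<le> ?ess h" if "h \<in> borel_measurable ?U" for h
  proof -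
    have "0 = esssup ?U (\<lambda>x. 0::ereal)" using esssup_const[OF U, of "0::ereal"] by simp
    also have "\<dots> \<le> ?ess h" by (rule esssup_mono) auto
    finally show ?thesis .
  qed
  have N: "ereal N = ?ess f" "0 \<le> N"
    using ffin nonneg[OF fm] by (auto simp: N_def ereal_real real_of_ereal_pos)
  obtain f' g where g: "f' \<in> borel_measurable borel" "g \<in> borel_measurable borel"
    "\<forall>x. x \<notin> {0..1} \<longrightarrow> f' x = 0" "AE x in lborel. x \<in> {0..1} \<longrightarrow> f x = f' x"
    "AE t in lborel. t \<in> {0..1} \<longrightarrow> RL_operator \<alpha> f t = g t
       \<and> ennreal \<bar>g t\<bar> \<le> ennreal C * dyadic_maximal f' t
       \<and> (dyadic_maximal f' t < \<infinity> \<longrightarrow> set_integrable lebesgue {0..t} (RL_integrand \<alpha> f t))"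
    by (rule RL_operator_borel_version[OF vo fm C(1)])
  have "AE x in ?U. ereal \<bar>f x\<bar> \<le> ereal N"
    unfolding N(1) by (rule esssup_AE)
  then have "AE x in lborel. x \<in> {0..1} \<longrightarrow> \<bar>f x\<bar> \<le> N"
    unfolding AE_unit_interval_iff by simp
  with g(4) have f'N: "AE x in lborel. \<bar>f' x\<bar> \<le> N"
  proof eventually_elim
    case (elim x)
    then show ?case using N(2) g(3) by (cases "x \<in> {0..1}") auto
  qed
  have M: "dyadic_maximal f' t \<le> ennreal (2 * N)" for t
    unfolding dyadic_maximal_def
  proof (rule SUP_least)
    fix k :: nat
    let ?I = "{t - (1/2) ^ k..t + (1/2) ^ k}"
    have "(\<integral>\<^sup>+ s\<in>?I. ennreal \<bar>f' s\<bar> \<partial>lborel) \<le> (\<integral>\<^sup>+ s\<in>?I. ennreal N \<partial>lborel)"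
      using f'N by (intro nn_integral_mono_AE) (auto elim!: eventually_mono simp: indicator_def intro: ennreal_leI)
    also have "\<dots> = ennreal N * emeasure lborel ?I"
      by (rule nn_integral_cmult_indicator) auto
    also have "\<dots> = ennreal ((1/2) ^ k) * ennreal (2 * N)"
      using N(2) by (simp add: mult_ac ennreal_mult[symmetric])
    finally have "2 ^ k * (\<integral>\<^sup>+ s\<in>?I. ennreal \<bar>f' s\<bar> \<partial>lborel) \<le> 2 ^ k * (ennreal ((1/2) ^ k) * ennreal (2 * N))"
      by (intro mult_left_mono) auto
    also have "\<dots> = ennreal (2 * N)"
      unfolding mult.assoc[symmetric] pow2_mult_pow_half_ennreal by simp
    finally show "2 ^ k * (\<integral>\<^sup>+ s\<in>?I. ennreal \<bar>f' s\<bar> \<partial>lborel) \<le> ennreal (2 * N)" .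
  qed
  have Mfin: "dyadic_maximal f' t < \<infinity>" for t
    using M[of t] by (auto simp: le_less_trans)
  show "AE t in ?U. set_integrable lebesgue {0..t} (RL_integrand \<alpha> f t)"
    unfolding AE_unit_interval_iff using g(5) by eventually_elim (use Mfin in auto)
  have RLg: "AE t in ?U. RL_operator \<alpha> f t = g t"
    unfolding AE_unit_interval_iff using g(5) by eventually_elim auto
  have RLm: "RL_operator \<alpha> f \<in> borel_measurable ?U"
    using borel_imp_unit_interval_measurable[OF g(2)] RLg unit_interval_measurable_AE_cong by blast
  have "AE t in ?U. ereal \<bar>RL_operator \<alpha> f t\<bar> \<le> ereal (2 * C * N)"
    unfolding AE_unit_interval_iff using g(5)
  proof eventually_elim
    case (elim t)
    show ?case
    proof
      assume t: "t \<in> {0..1}"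
      have "ennreal \<bar>g t\<bar> \<le> ennreal C * dyadic_maximal f' t" using elim t by blast
      also have "\<dots> \<le> ennreal C * ennreal (2 * N)" using M by (intro mult_left_mono) auto
      also have "\<dots> = ennreal (2 * C * N)" using N(2) C(2) by (subst ennreal_mult[symmetric]) (auto simp: mult_ac)
      finally have "\<bar>g t\<bar> \<le> 2 * C * N" using N(2) C(2) by (subst (asm) ennreal_le_iff) auto
      then show "ereal \<bar>RL_operator \<alpha> f t\<bar> \<le> ereal (2 * C * N)" using elim t by auto
    qed
  qed
  then have ess: "?ess (RL_operator \<alpha> f) \<le> ereal (2 * C * N)"
    using RLm by (intro esssup_I) auto
  then show "RL_operator \<alpha> f \<in> Lp_space \<infinity> ?U"
    using RLm by (auto simp: Lp_space_def le_less_trans)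
  show "Lp_norm \<infinity> ?U (RL_operator \<alpha> f) \<le> 2 * C * Lp_norm \<infinity> ?U f"
    using real_of_ereal_positive_mono[OF nonneg[OF RLm] ess] by (simp add: Lp_norm_def N_def)
qed

lemma nn_integral_unit_interval:
  "(\<integral>\<^sup>+ x. F x \<partial>unit_interval_measure) = (\<integral>\<^sup>+ x\<in>{0..1}. F x \<partial>lborel)"
  by (subst nn_integral_restrict_space) (auto simp: nn_integral_completion)

text \<open>
  Here \<open>C\<close> is the constant of the pointwise domination and \<open>K\<close> that of the maximal
  inequality for the \<open>q\<close>-th power integral, whence its \<open>q\<close>-th root in the norm bound.
\<close>

lemma RL_operator_Lp:
  assumes vo: "variable_order \<alpha>" and f: "f \<in> Lp_space p unit_interval_measure"
    and p: "p \<noteq> \<infinity>" "1 < enn2real p"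
    and C: "\<And>a. a > 0 \<Longrightarrow> 2 / (1 - 2 powr - a) * (1 / Gamma a) \<le> C" "C > 0"
  defines "q \<equiv> enn2real p"
  defines "K \<equiv> 20 * q * 4 powr (q - 1) / (q - 1)"
  shows "AE t in unit_interval_measure. set_integrable lebesgue {0..t} (RL_integrand \<alpha> f t)"
    and "RL_operator \<alpha> f \<in> Lp_space p unit_interval_measure"
    and "Lp_norm p unit_interval_measure (RL_operator \<alpha> f)
      \<le> C * K powr (1 / q) * Lp_norm p unit_interval_measure f"
proof -
  let ?U = unit_interval_measure
  have q: "1 < q" using p by (simp add: q_def)
  have K: "0 < K" unfolding K_def using q by auto
  have fm: "f \<in> borel_measurable ?U" and fint: "integrable ?U (\<lambda>x. \<bar>f x\<bar> powr q)"
    using f p by (auto simp: Lp_space_def q_def)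
  define I where "I = (LINT x|?U. \<bar>f x\<bar> powr q)"
  have I: "0 \<le> I" "(\<integral>\<^sup>+ x. ennreal (\<bar>f x\<bar> powr q) \<partial>?U) = ennreal I"
    using nn_integral_eq_integral[OF fint] by (auto simp: I_def)
  obtain f' g where g: "f' \<in> borel_measurable borel" "g \<in> borel_measurable borel"
    "\<forall>x. x \<notin> {0..1} \<longrightarrow> f' x = 0" "AE x in lborel. x \<in> {0..1} \<longrightarrow> f x = f' x"
    "AE t in lborel. t \<in> {0..1} \<longrightarrow> RL_operator \<alpha> f t = g t
       \<and> ennreal \<bar>g t\<bar> \<le> ennreal C * dyadic_maximal f' t
       \<and> (dyadic_maximal f' t < \<infinity> \<longrightarrow> set_integrable lebesgue {0..t} (RL_integrand \<alpha> f t))"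
    by (rule RL_operator_borel_version[OF vo fm C(1)])
  note [measurable] = g(1,2)
  have f'I: "(\<integral>\<^sup>+ x. ennreal (\<bar>f' x\<bar> powr q) \<partial>lborel) = ennreal I"
  proof -
    have "(\<integral>\<^sup>+ x. ennreal (\<bar>f' x\<bar> powr q) \<partial>lborel) = (\<integral>\<^sup>+ x\<in>{0..1}. ennreal (\<bar>f x\<bar> powr q) \<partial>lborel)"
      using g(4)
    proof (intro nn_integral_cong_AE, eventually_elim)
      case (elim x)
      then show ?case using g(3) q by (cases "x \<in> {0..1}") auto
    qed
    then show ?thesis using I(2) by (simp add: nn_integral_unit_interval)
  qed
  \<comment> \<open>On the unit interval \<open>\<bar>f'\<bar> \<le> 1 + \<bar>f'\<bar> powr q\<close>, so \<open>f'\<close> is integrable and its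
    maximal function is finite almost everywhere.\<close>
  have "(\<integral>\<^sup>+ x. ennreal \<bar>f' x\<bar> \<partial>lborel) \<le> (\<integral>\<^sup>+ x. indicator {0..1} x + ennreal (\<bar>f' x\<bar> powr q) \<partial>lborel)"
  proof (rule nn_integral_mono)
    fix x :: real
    have "\<bar>f' x\<bar> \<le> indicator {0..1} x + \<bar>f' x\<bar> powr q"
    proof (cases "\<bar>f' x\<bar> \<le> 1")
      case True
      then show ?thesis using g(3) by (auto simp: indicator_def intro: add_increasing2)
    next
      case False
      then have "\<bar>f' x\<bar> powr 1 \<le> \<bar>f' x\<bar> powr q" using q by (intro powr_mono) auto
      then show ?thesis using False by (auto simp: indicator_def)
    qed
    then have "ennreal \<bar>f' x\<bar> \<le> ennreal (indicator {0..1} x + \<bar>f' x\<bar> powr q)" by (rule ennreal_leI)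
    also have "\<dots> = indicator {0..1} x + ennreal (\<bar>f' x\<bar> powr q)"
      by (subst ennreal_plus) (auto simp: ennreal_indicator)
    finally show "ennreal \<bar>f' x\<bar> \<le> indicator {0..1} x + ennreal (\<bar>f' x\<bar> powr q)" .
  qed
  also have "\<dots> = 1 + ennreal I"
    using f'I by (subst nn_integral_add) auto
  also have "\<dots> < \<infinity>" by simp
  finally have "AE t in lborel. dyadic_maximal f' t < \<infinity>"
    by (intro dyadic_maximal_finite_AE) auto
  with g(5) show "AE t in ?U. set_integrable lebesgue {0..t} (RL_integrand \<alpha> f t)"
    unfolding AE_unit_interval_iff by eventually_elim auto
  have RLg: "AE t in ?U. RL_operator \<alpha> f t = g t"
    unfolding AE_unit_interval_iff using g(5) by eventually_elim auto
  have RLm: "RL_operator \<alpha> f \<in> borel_measurable ?U"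
    using borel_imp_unit_interval_measurable[OF g(2)] RLg unit_interval_measurable_AE_cong by blast
  \<comment> \<open>Dividing by \<open>C\<close> makes the image directly dominated by the maximal function.\<close>
  define h where "h t = indicator {0..1} t * g t / C" for t
  have "(\<integral>\<^sup>+ t. ennreal (\<bar>h t\<bar> powr q) \<partial>lborel) \<le> ennreal K * (\<integral>\<^sup>+ s. ennreal (\<bar>f' s\<bar> powr q) \<partial>lborel)"
    unfolding K_def
  proof (rule dyadic_maximal_strong_type)
    show "AE t in lborel. ennreal \<bar>h t\<bar> \<le> dyadic_maximal f' t"
      using g(5)
    proof eventually_elim
      case (elim t)
      show ?case
      proof (cases "t \<in> {0..1}")
        case True
        then have "ennreal (1 / C) * ennreal \<bar>g t\<bar> \<le> ennreal (1 / C) * (ennreal C * dyadic_maximal f' t)"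
          using elim by (intro mult_left_mono) auto
        also have "\<dots> = dyadic_maximal f' t"
          using C(2) by (simp add: mult.assoc[symmetric] ennreal_mult[symmetric])
        finally show ?thesis
          using True C(2) by (simp add: h_def ennreal_mult[symmetric])
      qed (simp add: h_def)
    qed
    show "h \<in> borel_measurable borel" unfolding h_def by measurable
  qed (use q in auto)
  then have hI: "(\<integral>\<^sup>+ t. ennreal (\<bar>h t\<bar> powr q) \<partial>lborel) \<le> ennreal (K * I)"
    using f'I K I by (simp add: ennreal_mult)
  have "(\<integral>\<^sup>+ t. ennreal (\<bar>RL_operator \<alpha> f t\<bar> powr q) \<partial>?U)
      = (\<integral>\<^sup>+ t. ennreal (C powr q) * ennreal (\<bar>h t\<bar> powr q) \<partial>lborel)"
    unfolding nn_integral_unit_interval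
    using RLg[unfolded AE_unit_interval_iff]
  proof (intro nn_integral_cong_AE, eventually_elim)
    case (elim t)
    then show ?case
      using C(2) q by (cases "t \<in> {0..1}")
        (auto simp: h_def ennreal_mult[symmetric] powr_mult[symmetric])
  qed
  also have "\<dots> = ennreal (C powr q) * (\<integral>\<^sup>+ t. ennreal (\<bar>h t\<bar> powr q) \<partial>lborel)"
    unfolding h_def by (rule nn_integral_cmult) measurable
  also have "\<dots> \<le> ennreal (C powr q) * ennreal (K * I)"
    using hI by (intro mult_left_mono) auto
  also have "\<dots> = ennreal (C powr q * (K * I))"
    using K I by (intro ennreal_mult[symmetric]) auto
  finally have RLI: "(\<integral>\<^sup>+ t. ennreal (\<bar>RL_operator \<alpha> f t\<bar> powr q) \<partial>?U) \<le> ennreal (C powr q * (K * I))" .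
  have RLint: "integrable ?U (\<lambda>t. \<bar>RL_operator \<alpha> f t\<bar> powr q)"
    using RLm RLI by (intro integrableI_bounded) (auto simp: le_less_trans)
  then show "RL_operator \<alpha> f \<in> Lp_space p ?U"
    using RLm p by (auto simp: Lp_space_def q_def)
  have "(LINT t|?U. \<bar>RL_operator \<alpha> f t\<bar> powr q) \<le> C powr q * (K * I)"
    using RLI nn_integral_eq_integral[OF RLint] K I by (simp add: ennreal_le_iff)
  then have "(LINT t|?U. \<bar>RL_operator \<alpha> f t\<bar> powr q) powr (1 / q) \<le> (C powr q * (K * I)) powr (1 / q)"
    using q by (intro powr_mono2) (auto intro!: Bochner_Integration.integral_nonneg)
  also have "\<dots> = C * K powr (1 / q) * I powr (1 / q)"
    using q K I C(2) by (simp add: powr_mult powr_powr)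
  finally show "Lp_norm p ?U (RL_operator \<alpha> f) \<le> C * K powr (1 / q) * Lp_norm p ?U f"
    using p by (simp add: Lp_norm_def q_def I_def)
qed

text \<open>
  The constant is chosen before the order and the function, so it depends on \<open>p\<close> only.
\<close>

lemma RL_operator_uniformly_bounded:
  assumes "1 < p"
  shows "\<exists>c>0. \<forall>\<alpha> f. variable_order \<alpha> \<longrightarrow> f \<in> Lp_space p unit_interval_measure \<longrightarrow>
    (AE t in unit_interval_measure. set_integrable lebesgue {0..t} (RL_integrand \<alpha> f t))
    \<and> RL_operator \<alpha> f \<in> Lp_space p unit_interval_measure
    \<and> Lp_norm p unit_interval_measure (RL_operator \<alpha> f) \<le> c * Lp_norm p unit_interval_measure f"
proof -
  obtain C where C: "C > 0" "\<And>a. a > 0 \<Longrightarrow> 2 / (1 - 2 powr - a) * (1 / Gamma a) \<le> (C::real)"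
    using RL_constant_bound by auto
  show ?thesis
  proof (cases "p = \<infinity>")
    case True
    then show ?thesis
      using RL_operator_L_infinity[OF _ _ C(2,1)] C(1) by (intro exI[of _ "2 * C"]) auto
  next
    case False
    have p: "1 < enn2real p"
      using assms False by (cases p) auto
    have "0 < C * (20 * enn2real p * 4 powr (enn2real p - 1) / (enn2real p - 1)) powr (1 / enn2real p)"
      using C(1) p by (intro mult_pos_pos) auto
    then show ?thesis
      using RL_operator_Lp[OF _ _ False p C(2,1)] by blast
  qed
qed

section \<open>Boundedness on the Lebesgue spaces\<close>

theorem theorem1p1:
  fixes p :: ennreal
  assumes "1 < p"
  shows "(\<forall>\<alpha>. variable_order \<alpha> \<longrightarrow>
            (\<forall>f\<in>Lp_space p unit_interval_measure. AE t in unit_interval_measure.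
               set_integrable lebesgue {0..t} (RL_integrand \<alpha> f t)) \<and>
            bounded_Lp_operator p unit_interval_measure (RL_operator \<alpha>)) \<and>
         (\<exists>c::real. c > 0 \<and> (\<forall>\<alpha>. variable_order \<alpha> \<longrightarrow>
            Lp_opnorm p unit_interval_measure (RL_operator \<alpha>) \<le> ereal c))"
proof -
  let ?U = unit_interval_measure
  obtain c where c: "c > 0" and
    int: "\<And>\<alpha> f. variable_order \<alpha> \<Longrightarrow> f \<in> Lp_space p ?U \<Longrightarrow>
      AE t in ?U. set_integrable lebesgue {0..t} (RL_integrand \<alpha> f t)" and
    Lp: "\<And>\<alpha> f. variable_order \<alpha> \<Longrightarrow> f \<in> Lp_space p ?U \<Longrightarrow> RL_operator \<alpha> f \<in> Lp_space p ?U" and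
    norm: "\<And>\<alpha> f. variable_order \<alpha> \<Longrightarrow> f \<in> Lp_space p ?U \<Longrightarrow>
      Lp_norm p ?U (RL_operator \<alpha> f) \<le> c * Lp_norm p ?U f"
    using RL_operator_uniformly_bounded[OF assms] by blast
  have meas: "f \<in> borel_measurable ?U" if "f \<in> Lp_space p ?U" for f
    using that by (simp add: Lp_space_def)
  have "bounded_Lp_operator p ?U (RL_operator \<alpha>)" if vo: "variable_order \<alpha>" for \<alpha>
    unfolding bounded_Lp_operator_def
  proof (intro conjI ballI allI impI)
    fix f g assume fg: "f \<in> Lp_space p ?U" "g \<in> Lp_space p ?U"
    show "AE x in ?U. RL_operator \<alpha> f x = RL_operator \<alpha> g x" if "AE x in ?U. f x = g x"
      using RL_operator_AE_cong(1)[OF meas[OF fg(1)] meas[OF fg(2)], of _ \<alpha> \<alpha>] that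
      unfolding AE_unit_interval_iff by (intro AE_I2) auto
    show "AE x in ?U. RL_operator \<alpha> (\<lambda>y. f y + g y) x = RL_operator \<alpha> f x + RL_operator \<alpha> g x"
      using int[OF vo fg(1)] int[OF vo fg(2)]
    proof eventually_elim
      case (elim t)
      have "RL_integrand \<alpha> (\<lambda>y. f y + g y) t = (\<lambda>s. RL_integrand \<alpha> f t s + RL_integrand \<alpha> g t s)"
        by (simp add: RL_integrand_def fun_eq_iff distrib_left)
      then show ?case
        using set_integral_add(2)[OF elim] by (simp add: RL_operator_def algebra_simps add_divide_distrib)
    qed
  next
    fix f and a :: real assume "f \<in> Lp_space p ?U"
    have "RL_integrand \<alpha> (\<lambda>y. a * f y) t = (\<lambda>s. a * RL_integrand \<alpha> f t s)" for t
      by (simp add: RL_integrand_def fun_eq_iff mult_ac)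
    then show "AE x in ?U. RL_operator \<alpha> (\<lambda>y. a * f y) x = a * RL_operator \<alpha> f x"
      by (simp add: RL_operator_def)
  qed (use Lp[OF vo] norm[OF vo] in auto)
  moreover have "Lp_opnorm p ?U (RL_operator \<alpha>) \<le> ereal c" if vo: "variable_order \<alpha>" for \<alpha>
    unfolding Lp_opnorm_def
  proof (rule SUP_least)
    fix f assume "f \<in> {f \<in> Lp_space p ?U. Lp_norm p ?U f \<le> 1}"
    then have f: "f \<in> Lp_space p ?U" "Lp_norm p ?U f \<le> 1" by auto
    have "Lp_norm p ?U (RL_operator \<alpha> f) \<le> c * Lp_norm p ?U f" by (rule norm[OF vo f(1)])
    also have "\<dots> \<le> c * 1" using f(2) c by (intro mult_left_mono) auto
    finally show "ereal (Lp_norm p ?U (RL_operator \<alpha> f)) \<le> ereal c" by simp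
  qed
  ultimately show ?thesis using int c by blast
qed

end
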